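(* Let $\mathbf{C}$ be an arbitrary category, let $\mathbf{Bla}(\mathbf{C})$ be the category described in the context, and let $U\colon\mathbf{Bla}(\mathbf{C})\to\mathbf{C}$, $U(B,R,m,e)=B$, be the forgetful functor. Suppose given a (split-epi, mono) factorization of $U$ in $\mathsf{Cat}$, i.e. a category $\mathbf{C}^{*}$ and functors $Q\colon\mathbf{Bla}(\mathbf{C})\to\mathbf{C}^{*}$, $R\colon\mathbf{C}^{*}\to\mathbf{Bla}(\mathbf{C})$ and a monomorphism $V\colon\mathbf{C}^{*}\hookrightarrow\mathbf{C}$ in $\mathsf{Cat}$ with $U=VQ$, $QR=1$ (and hence $UR=V$). Let $H_R\colon\mathbf{C}^{\mathrm{op}}\times\mathbf{C}^{*}\to\mathsf{Set}$ be the induced bifunctor described in the context. Then a family $(H,\mathrm{dom},\mathrm{cod},0,+)_{A,B}$, indexed by pairs of objects $A,B$ of $\mathbf{C}^{*}$, with $$H(A,B)\subseteq H_R(A,B),$$ $$\mathrm{dom}_{A,B}\left(\begin{bmatrix} f\\ t\\ g\end{bmatrix}\right)=f,\qquad \mathrm{cod}_{A,B}\left(\begin{bmatrix} f\\ t\\ g\end{bmatrix}\right)=g,\qquad 0_{A,B}(f)=\begin{bmatrix} f\\ e_Bf\\ f\end{bmatrix},$$ $$\begin{bmatrix} g\\ t'\\ h\end{bmatrix}+\begin{bmatrix} f\\ t\\ g\end{bmatrix}=\begin{bmatrix} f\\ m_B\langle t',g,t\rangle\\ h\end{bmatrix},$$ together with the family $$\mu_{A',A,B,B'}\left(u,\begin{bmatrix}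 f\\ t\\ g\end{bmatrix},v\right)=H_R(v,u)\left(\begin{bmatrix} f\\ t\\ g\end{bmatrix}\right)=\begin{bmatrix} ufv\\ utv\\ ugv\end{bmatrix},$$ gives a 2-cell structure over $\mathbf{C}^{*}$ if and only if the following conditions hold (for all objects $A,A',B,B'$ of $\mathbf{C}^{*}$): (1) if $\begin{bmatrix} f\\ t\\ g\end{bmatrix}\in H(A,B)$ then $\begin{bmatrix} ufv\\ utv\\ ugv\end{bmatrix}\in H(A',B')$ for all morphisms $u\colon B\to B'$ and $v\colon A'\to A$ in $\mathbf{C}^{*}$; (2) if $\begin{bmatrix} f\\ t\\ g\end{bmatrix}\in H(A,B)$ then $f$ and $g$ are morphisms in $\mathbf{C}^{*}$; (3) for every morphism $f\colon A\to B$ in $\mathbf{C}^{*}$, $\begin{bmatrix} f\\ e_Bf\\ f\end{bmatrix}\in H(A,B)$; (4) if $\begin{bmatrix} g\\ t'\\ h\end{bmatrix},\begin{bmatrix} f\\ t\\ g\end{bmatrix}\in H(A,B)$ then $\begin{bmatrix} g\\ t'\\ h\end{bmatrix}+\begin{bmatrix} f\\ t\\ g\end{bmatrix}\in H(A,B)$; (5) if $\begin{bmatrix} f\\ t\\ g\end{bmatrix}\in H(A,B)$ then $m_B\langle t,f,e_Bf\rangle=t=m_B\langle e_Bg,g,t\rangle$; (6) if $\begin{bmatrix} h\\ t''\\ k\end{bmatrix},\begin{bmatrix} g\\ t'\\ h\end{bmatrix},\begin{bmatrix} f\\ t\\ g\end{bmatrix}\in H(A,B)$ then $m_B\langle t'',h,m_B\langle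 t',g,t\rangle\rangle=m_B\langle m_B\langle t'',h,t'\rangle,g,t\rangle$.
   Context: 2-cell structure. A 2-cell structure over a category $\mathbf{D}$ consists of a bifunctor $H\colon\mathbf{D}^{\mathrm{op}}\times\mathbf{D}\to\mathsf{Set}$ together with natural transformations $\mathrm{dom},\mathrm{cod}\colon H\Rightarrow\hom_{\mathbf{D}}$, $0\colon\hom_{\mathbf{D}}\Rightarrow H$ and $+\colon H\times_{\langle\mathrm{dom},\mathrm{cod}\rangle}H\Rightarrow H$ making $(H,\hom_{\mathbf{D}},\mathrm{dom},\mathrm{cod},0,+)$ an internal category in the functor category $\mathsf{Set}^{\mathbf{D}^{\mathrm{op}}\times\mathbf{D}}$, with object of objects $\hom_{\mathbf{D}}$ and object of morphisms $H$; here $x'+x$ is defined when $\mathrm{dom}(x')=\mathrm{cod}(x)$, with $\mathrm{dom}(x'+x)=\mathrm{dom}(x)$ and $\mathrm{cod}(x'+x)=\mathrm{cod}(x')$. The action of the bifunctor is encoded by maps $\mu_{A',A,B,B'}\colon\hom(B,B')\times H(A,B)\times\hom(A',A)\to H(A',B')$, $\mu_{A',A,B,B'}(u,x,v)=H(v,u)(x)$. In the claim $\mathbf{D}=\mathbf{C}^{*}$. The category $\mathbf{Bla}(\mathbf{C})$. Its objects are four-tuples $(B,R,m,e)$ where $B$ is an object of $\mathbf{C}$, $R$ is a ternary relation on $B$ (that is, an object $R$ of $\mathbf{C}$ with three jointly monic projection morphisms $\pi_1,\pi_2,\pi_3\colon R\to B$, as part of the structure; products need not exist in $\mathbf{C}$),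 and $e\colon B\to B$, $m\colon R\to B$ are morphisms in $\mathbf{C}$, subject to: (i) for every object $A$ in $\mathbf{C}$ and every three parallel morphisms $x,y,z\colon A\to B$, if $\langle x,y,ey\rangle$ and $\langle ey,y,z\rangle$ factor through $R$, then $\langle x,y,z\rangle$ factors through $R$; (ii) for every $x\colon A\to B$, $\langle ex,x,ex\rangle$ factors through $R$. For $x,y,z\colon A\to B$, "$\langle x,y,z\rangle$ factors through $R$" means that there is a (necessarily unique) morphism $w\colon A\to R$ with $\pi_1w=x$, $\pi_2w=y$, $\pi_3w=z$; in that case $m\langle x,y,z\rangle$ denotes $mw\colon A\to B$. A morphism $(B,R,m,e)\to(B',R',m',e')$ is a morphism $u\colon B\to B'$ in $\mathbf{C}$ such that $e'u=ue$ and, whenever $\langle x,y,z\rangle$ factors through $R$, $\langle ux,uy,uz\rangle$ factors through $R'$ and $u\,m\langle x,y,z\rangle=m'\langle ux,uy,uz\rangle$. The category $\mathbf{C}^{*}$ and the bifunctor $H_R$. $\mathbf{C}^{*}$ is identified with its image in $\mathbf{C}$ under $V$. For an object $B$ of $\mathbf{C}^{*}$ write $R(B)=(B,R_B,m_B,e_B)$; the morphisms $B\to B'$ in $\mathbf{C}^{*}$ are the morphisms $u\colon B\to B'$ of $\mathbf{C}$ such that $e_{B'}u=ue_B$ and, whenever $\langle x,y,z\rangle$ factors through $R_B$, $\langle ux,uy,uz\rangle$ factors through $R_{B'}$ and $u\,m_B\langle x,y,z\rangle=m_{B'}\langle ux,uy,uz\rangle$. For $A$ in $\mathbf{C}$ and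 $B$ in $\mathbf{C}^{*}$, $H_R(A,B)$ is the set of column vectors $\begin{bmatrix} f\\ t\\ g\end{bmatrix}$ with $f,t,g\colon A\to B$ morphisms in $\mathbf{C}$ such that $\langle t,f,e_Bf\rangle$ and $\langle e_Bg,g,t\rangle$ factor through $R_B$; for $v\colon A'\to A$ in $\mathbf{C}$ and $u\colon B\to B'$ in $\mathbf{C}^{*}$, $H_R(v,u)$ sends $\begin{bmatrix} f\\ t\\ g\end{bmatrix}$ to $\begin{bmatrix} ufv\\ utv\\ ugv\end{bmatrix}$. $\mathsf{Cat}$ is the category of categories and functors. *)

theory Defs
  imports Main
begin

section \<open>Categories, functors, monomorphisms in Cat\<close>

record ('o, 'a) cat =
  Obj :: "'o set"
  Arr :: "'a set"
  src :: "'a \<Rightarrow> 'o"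
  tgt :: "'a \<Rightarrow> 'o"
  idn :: "'o \<Rightarrow> 'a"
  cmp :: "'a \<Rightarrow> 'a \<Rightarrow> 'a" (infixl \<open>\<cdot>\<index>\<close> 70)

text \<open>\<open>g \<cdot> f\<close> is \<open>g\<close> after \<open>f\<close>.  Outside the carriers \<open>Obj\<close> and \<open>Arr\<close>, and on
  non-composable pairs, the operations are unconstrained.\<close>

definition hom :: "('o, 'a, 'z) cat_scheme \<Rightarrow> 'o \<Rightarrow> 'o \<Rightarrow> 'a set" where
  "hom C A B = {f \<in> Arr C. src C f = A \<and> tgt C f = B}"

definition category :: "('o, 'a, 'z) cat_scheme \<Rightarrow> bool" where
  "category C \<longleftrightarrow>
     (\<forall>f\<in>Arr C. src C f \<in> Obj C \<and> tgt C f \<in> Obj C) \<and>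
     (\<forall>A\<in>Obj C. idn C A \<in> hom C A A) \<and>
     (\<forall>f\<in>Arr C. \<forall>g\<in>Arr C. tgt C f = src C g \<longrightarrow> g \<cdot>\<^bsub>C\<^esub> f \<in> hom C (src C f) (tgt C g)) \<and>
     (\<forall>f\<in>Arr C. f \<cdot>\<^bsub>C\<^esub> idn C (src C f) = f \<and> idn C (tgt C f) \<cdot>\<^bsub>C\<^esub> f = f) \<and>
     (\<forall>f\<in>Arr C. \<forall>g\<in>Arr C. \<forall>h\<in>Arr C. tgt C f = src C g \<longrightarrow> tgt C g = src C h \<longrightarrow>
        h \<cdot>\<^bsub>C\<^esub> (g \<cdot>\<^bsub>C\<^esub> f) = (h \<cdot>\<^bsub>C\<^esub> g) \<cdot>\<^bsub>C\<^esub> f)"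

definition op_cat :: "('o, 'a) cat \<Rightarrow> ('o, 'a) cat" where
  "op_cat C = \<lparr>Obj = Obj C, Arr = Arr C, src = tgt C, tgt = src C, idn = idn C,
     cmp = (\<lambda>g f. f \<cdot>\<^bsub>C\<^esub> g)\<rparr>"

definition prod_cat :: "('o, 'a) cat \<Rightarrow> ('p, 'b) cat \<Rightarrow> ('o \<times> 'p, 'a \<times> 'b) cat" where
  "prod_cat C D = \<lparr>Obj = Obj C \<times> Obj D, Arr = Arr C \<times> Arr D,
     src = map_prod (src C) (src D), tgt = map_prod (tgt C) (tgt D),
     idn = map_prod (idn C) (idn D),
     cmp = (\<lambda>(g, g') (f, f'). (g \<cdot>\<^bsub>C\<^esub> f, g' \<cdot>\<^bsub>D\<^esub> f'))\<rparr>"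

record ('o, 'a, 'p, 'b) func =
  omap :: "'o \<Rightarrow> 'p"
  amap :: "'a \<Rightarrow> 'b"

definition is_functor :: "('o, 'a) cat \<Rightarrow> ('p, 'b) cat \<Rightarrow> ('o, 'a, 'p, 'b) func \<Rightarrow> bool" where
  "is_functor C D F \<longleftrightarrow>
     (\<forall>A\<in>Obj C. omap F A \<in> Obj D) \<and>
     (\<forall>f\<in>Arr C. amap F f \<in> hom D (omap F (src C f)) (omap F (tgt C f))) \<and>
     (\<forall>A\<in>Obj C. amap F (idn C A) = idn D (omap F A)) \<and>
     (\<forall>f\<in>Arr C. \<forall>g\<in>Arr C. tgt C f = src C g \<longrightarrow>
        amap F (g \<cdot>\<^bsub>C\<^esub> f) = amap F g \<cdot>\<^bsub>D\<^esub> amap F f)"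

definition id_functor :: "('o, 'a, 'o, 'a) func" where
  "id_functor = \<lparr>omap = id, amap = id\<rparr>"

definition comp_functor ::
    "('p, 'b, 'q, 'c) func \<Rightarrow> ('o, 'a, 'p, 'b) func \<Rightarrow> ('o, 'a, 'q, 'c) func" where
  "comp_functor G F = \<lparr>omap = omap G \<circ> omap F, amap = amap G \<circ> amap F\<rparr>"

text \<open>Equality of functors with domain \<open>C\<close>: the values outside the carriers are irrelevant.\<close>

definition functor_eq ::
    "('o, 'a) cat \<Rightarrow> ('o, 'a, 'p, 'b) func \<Rightarrow> ('o, 'a, 'p, 'b) func \<Rightarrow> bool" where
  "functor_eq C F G \<longleftrightarrow>
     (\<forall>A\<in>Obj C. omap F A = omap G A) \<and> (\<forall>f\<in>Arr C. amap F f = amap G f)"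

text \<open>Monomorphisms in Cat.  A definition cannot quantify over the types carrying the test
  category \<open>X\<close>, so \<open>X\<close> is taken over \<open>nat\<close>; lemma \<open>mono_Cat_cancel\<close> below shows that left
  cancellability then holds for test categories over arbitrary types.\<close>

definition mono_Cat :: "('o, 'a) cat \<Rightarrow> ('p, 'b) cat \<Rightarrow> ('o, 'a, 'p, 'b) func \<Rightarrow> bool" where
  "mono_Cat C D V \<longleftrightarrow> is_functor C D V \<and>
     (\<forall>(X :: (nat, nat) cat) F G.
        category X \<longrightarrow> is_functor X C F \<longrightarrow> is_functor X C G \<longrightarrow>
        functor_eq X (comp_functor V F) (comp_functor V G) \<longrightarrow> functor_eq X F G)"

definition walking_arrow :: "(nat, nat) cat" where
  "walking_arrow = \<lparr>Obj = {0, 1}, Arr = {0, 1, 2},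
     src = (\<lambda>k. if k = 1 then 1 else 0), tgt = (\<lambda>k. if k = 0 then 0 else 1), idn = id,
     cmp = (\<lambda>g f. if f = 0 then g else if g = 1 then f else 2)\<rparr>"

lemma category_walking_arrow: "category walking_arrow"
  by (auto simp: category_def walking_arrow_def hom_def)

lemma mono_Cat_inj:
  assumes C: "category C" and D: "category D" and m: "mono_Cat C D V"
  shows "inj_on (omap V) (Obj C)" "inj_on (amap V) (Arr C)"
proof -
  define W where "W f = \<lparr>omap = (\<lambda>k::nat. if k = 0 then src C f else tgt C f),
      amap = (\<lambda>k::nat. if k = 0 then idn C (src C f) else if k = 1 then idn C (tgt C f) else f)\<rparr>"
    for f
  have V: "is_functor C D V" using m by (simp add: mono_Cat_def)
  have W: "is_functor walking_arrow C (W f)" if "f \<in> Arr C" for f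
  proof -
    have ii: "idn C A \<cdot>\<^bsub>C\<^esub> idn C A = idn C A" if "A \<in> Obj C" for A
    proof -
      have "idn C A \<in> Arr C \<and> src C (idn C A) = A"
        using C that by (simp add: category_def hom_def)
      then show ?thesis using C unfolding category_def by metis
    qed
    have "src C f \<in> Obj C" "tgt C f \<in> Obj C" using C that by (auto simp: category_def)
    note this ii[OF this(1)] ii[OF this(2)]
    then show ?thesis
      using that C unfolding is_functor_def walking_arrow_def W_def category_def hom_def
      by simp
  qed
  have key: "f = g" if "f \<in> Arr C" "g \<in> Arr C" "amap V f = amap V g"
      "omap V (src C f) = omap V (src C g)" "omap V (tgt C f) = omap V (tgt C g)" for f g
  proof -
    have i: "src C f \<in> Obj C" "src C g \<in> Obj C" "tgt C f \<in> Obj C" "tgt C g \<in> Obj C"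
      using C that by (auto simp: category_def)
    have "amap V (idn C (src C f)) = amap V (idn C (src C g))"
         "amap V (idn C (tgt C f)) = amap V (idn C (tgt C g))"
      using V i that unfolding is_functor_def by auto
    then have "functor_eq walking_arrow (comp_functor V (W f)) (comp_functor V (W g))"
      using that by (auto simp: functor_eq_def comp_functor_def W_def)
    then have "functor_eq walking_arrow (W f) (W g)"
      using m W that category_walking_arrow unfolding mono_Cat_def by blast
    then show ?thesis by (auto simp: functor_eq_def walking_arrow_def W_def)
  qed
  show "inj_on (omap V) (Obj C)"
  proof (rule inj_onI)
    fix A B assume a: "A \<in> Obj C" "B \<in> Obj C" "omap V A = omap V B"
    have h: "idn C A \<in> hom C A A" "idn C B \<in> hom C B B" using C a by (auto simp: category_def)
    moreover have "amap V (idn C A) = amap V (idn C B)"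
      using V a by (simp add: is_functor_def)
    ultimately have "idn C A = idn C B" using key a by (auto simp: hom_def)
    then show "A = B" using h by (auto simp: hom_def)
  qed
  show "inj_on (amap V) (Arr C)"
  proof (rule inj_onI)
    fix f g assume a: "f \<in> Arr C" "g \<in> Arr C" "amap V f = amap V g"
    have "amap V f \<in> hom D (omap V (src C f)) (omap V (tgt C f))"
         "amap V g \<in> hom D (omap V (src C g)) (omap V (tgt C g))"
      using V a unfolding is_functor_def by auto
    then show "f = g" using key a by (auto simp: hom_def)
  qed
qed

lemma mono_Cat_cancel:
  fixes X :: "('x, 'y) cat"
  assumes "category C" "category D" "mono_Cat C D V"
    and "is_functor X C F" "is_functor X C G"
    and "functor_eq X (comp_functor V F) (comp_functor V G)"
  shows "functor_eq X F G"
  using mono_Cat_inj[OF assms(1-3)] assms(4-6)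
  unfolding functor_eq_def comp_functor_def is_functor_def hom_def inj_on_def
  by simp

text \<open>The image of a functor \<open>V : Cs \<rightarrow> C\<close>; for \<open>V\<close> mono this is a subcategory of \<open>C\<close>
  isomorphic to \<open>Cs\<close>.\<close>

definition image_cat :: "('p, 'b) cat \<Rightarrow> ('o, 'a) cat \<Rightarrow> ('p, 'b, 'o, 'a) func \<Rightarrow> ('o, 'a) cat" where
  "image_cat Cs C V = C\<lparr>Obj := omap V ` Obj Cs, Arr := amap V ` Arr Cs\<rparr>"

lemma category_image_cat:
  assumes C: "category C" and Cs: "category Cs" and m: "mono_Cat Cs C V"
  shows "category (image_cat Cs C V)"
proof -
  have V: "is_functor Cs C V" using m by (simp add: mono_Cat_def)
  have iO: "inj_on (omap V) (Obj Cs)" using mono_Cat_inj[OF Cs C m] by simp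
  have VA: "amap V f \<in> Arr C" "src C (amap V f) = omap V (src Cs f)"
    "tgt C (amap V f) = omap V (tgt Cs f)" "src Cs f \<in> Obj Cs" "tgt Cs f \<in> Obj Cs"
    if "f \<in> Arr Cs" for f
    using that V Cs by (auto simp: is_functor_def hom_def category_def)
  have comp: "g \<cdot>\<^bsub>C\<^esub> f \<in> amap V ` Arr Cs"
    if h: "f \<in> amap V ` Arr Cs" "g \<in> amap V ` Arr Cs" "tgt C f = src C g" for f g
  proof -
    obtain f' g' where fg: "f' \<in> Arr Cs" "g' \<in> Arr Cs" "f = amap V f'" "g = amap V g'"
      using h by blast
    then have "tgt Cs f' = src Cs g'" using h VA iO by (auto dest: inj_onD)
    then have "g \<cdot>\<^bsub>C\<^esub> f = amap V (g' \<cdot>\<^bsub>Cs\<^esub> f')" "g' \<cdot>\<^bsub>Cs\<^esub> f' \<in> Arr Cs"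
      using V Cs fg by (auto simp: is_functor_def category_def hom_def)
    then show ?thesis by simp
  qed
  have idn: "idn C A \<in> amap V ` Arr Cs" if A: "A \<in> omap V ` Obj Cs" for A
  proof -
    obtain A' where A': "A' \<in> Obj Cs" "A = omap V A'" using A by blast
    have "idn Cs A' \<in> Arr Cs" "amap V (idn Cs A') = idn C A"
      using A' V Cs by (simp_all add: is_functor_def category_def hom_def)
    then show ?thesis by (metis imageI)
  qed
  have sub: "amap V ` Arr Cs \<subseteq> Arr C" "omap V ` Obj Cs \<subseteq> Obj C"
    using V VA by (auto simp: is_functor_def)
  have st: "src C f \<in> omap V ` Obj Cs" "tgt C f \<in> omap V ` Obj Cs"
    if "f \<in> amap V ` Arr Cs" for f
    using that VA by auto
  let ?D = "image_cat Cs C V"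
  have D: "Obj ?D = omap V ` Obj Cs" "Arr ?D = amap V ` Arr Cs" "src ?D = src C"
    "tgt ?D = tgt C" "idn ?D = idn C" "cmp ?D = cmp C"
    by (simp_all add: image_cat_def)
  show ?thesis
    unfolding category_def[of ?D] hom_def D
  proof (intro conjI ballI impI)
    fix A assume A: "A \<in> omap V ` Obj Cs"
    have "idn C A \<in> hom C A A" using A sub C unfolding category_def by blast
    then show "idn C A \<in> {f \<in> amap V ` Arr Cs. src C f = A \<and> tgt C f = A}"
      using idn[OF A] by (simp add: hom_def)
  next
    fix f g assume fg: "f \<in> amap V ` Arr Cs" "g \<in> amap V ` Arr Cs" "tgt C f = src C g"
    have "g \<cdot>\<^bsub>C\<^esub> f \<in> hom C (src C f) (tgt C g)"
      using fg sub C unfolding category_def by blast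
    then show "g \<cdot>\<^bsub>C\<^esub> f \<in> {h \<in> amap V ` Arr Cs. src C h = src C f \<and> tgt C h = tgt C g}"
      using comp[OF fg] by (simp add: hom_def)
  qed (use C sub st in \<open>unfold category_def, blast+\<close>)
qed


section \<open>Set-valued functors and internal categories in functor categories\<close>

record ('o, 'a, 'x) setfun =
  sobj :: "'o \<Rightarrow> 'x set"
  sarr :: "'a \<Rightarrow> 'x \<Rightarrow> 'x"

definition set_functor :: "('o, 'a) cat \<Rightarrow> ('o, 'a, 'x) setfun \<Rightarrow> bool" where
  "set_functor E F \<longleftrightarrow>
     (\<forall>k\<in>Arr E. \<forall>x\<in>sobj F (src E k). sarr F k x \<in> sobj F (tgt E k)) \<and>
     (\<forall>X\<in>Obj E. \<forall>x\<in>sobj F X. sarr F (idn E X) x = x) \<and>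
     (\<forall>k\<in>Arr E. \<forall>l\<in>Arr E. tgt E k = src E l \<longrightarrow>
        (\<forall>x\<in>sobj F (src E k). sarr F (l \<cdot>\<^bsub>E\<^esub> k) x = sarr F l (sarr F k x)))"

definition nat_trans ::
    "('o, 'a) cat \<Rightarrow> ('o, 'a, 'x) setfun \<Rightarrow> ('o, 'a, 'y) setfun \<Rightarrow> ('o \<Rightarrow> 'x \<Rightarrow> 'y) \<Rightarrow> bool" where
  "nat_trans E F G \<tau> \<longleftrightarrow> set_functor E F \<and> set_functor E G \<and>
     (\<forall>X\<in>Obj E. \<forall>x\<in>sobj F X. \<tau> X x \<in> sobj G X) \<and>
     (\<forall>k\<in>Arr E. \<forall>x\<in>sobj F (src E k).
        \<tau> (tgt E k) (sarr F k x) = sarr G k (\<tau> (src E k) x))"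

text \<open>Pullbacks of Set-valued functors are computed pointwise: the pullback of \<open>d\<close> and \<open>c\<close>
  consists of the pairs \<open>(x', x)\<close> with \<open>d x' = c x\<close>.\<close>

definition pullback_functor ::
    "('o, 'a, 'x) setfun \<Rightarrow> ('o, 'a, 'y) setfun \<Rightarrow> ('o \<Rightarrow> 'x \<Rightarrow> 'z) \<Rightarrow> ('o \<Rightarrow> 'y \<Rightarrow> 'z)
      \<Rightarrow> ('o, 'a, 'x \<times> 'y) setfun" where
  "pullback_functor F G d c =
     \<lparr>sobj = (\<lambda>X. {(x', x). x' \<in> sobj F X \<and> x \<in> sobj G X \<and> d X x' = c X x}),
      sarr = (\<lambda>k. map_prod (sarr F k) (sarr G k))\<rparr>"

text \<open>\<open>(C1, C0, d, c, i, p)\<close> is an internal category in \<open>Set\<^sup>E\<close>: \<open>C0\<close> is the object of objects,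
  \<open>C1\<close> the object of morphisms, and \<open>p (x', x)\<close> is \<open>x'\<close> after \<open>x\<close>.  The axioms are equations
  between natural transformations, written out on elements.\<close>

definition internal_category ::
    "('o, 'a) cat \<Rightarrow> ('o, 'a, 'x) setfun \<Rightarrow> ('o, 'a, 'y) setfun \<Rightarrow> ('o \<Rightarrow> 'x \<Rightarrow> 'y) \<Rightarrow> ('o \<Rightarrow> 'x \<Rightarrow> 'y)
      \<Rightarrow> ('o \<Rightarrow> 'y \<Rightarrow> 'x) \<Rightarrow> ('o \<Rightarrow> 'x \<times> 'x \<Rightarrow> 'x) \<Rightarrow> bool" where
  "internal_category E C1 C0 d c i p \<longleftrightarrow>
     nat_trans E C1 C0 d \<and> nat_trans E C1 C0 c \<and> nat_trans E C0 C1 i \<and>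
     nat_trans E (pullback_functor C1 C1 d c) C1 p \<and>
     (\<forall>X\<in>Obj E.
        (\<forall>f\<in>sobj C0 X. d X (i X f) = f \<and> c X (i X f) = f) \<and>
        (\<forall>x'\<in>sobj C1 X. \<forall>x\<in>sobj C1 X. d X x' = c X x \<longrightarrow>
           d X (p X (x', x)) = d X x \<and> c X (p X (x', x)) = c X x') \<and>
        (\<forall>x\<in>sobj C1 X. p X (x, i X (d X x)) = x \<and> p X (i X (c X x), x) = x) \<and>
        (\<forall>x''\<in>sobj C1 X. \<forall>x'\<in>sobj C1 X. \<forall>x\<in>sobj C1 X.
           d X x'' = c X x' \<longrightarrow> d X x' = c X x \<longrightarrow>
           p X (x'', p X (x', x)) = p X (p X (x'', x'), x)))"

definition hom_functor :: "('o, 'a) cat \<Rightarrow> ('o \<times> 'o, 'a \<times> 'a, 'a) setfun" where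
  "hom_functor D = \<lparr>sobj = (\<lambda>(A, B). hom D A B), sarr = (\<lambda>(v, u) f. u \<cdot>\<^bsub>D\<^esub> f \<cdot>\<^bsub>D\<^esub> v)\<rparr>"

definition two_cell_structure ::
    "('o, 'a) cat \<Rightarrow> ('o \<times> 'o, 'a \<times> 'a, 'x) setfun
      \<Rightarrow> ('o \<times> 'o \<Rightarrow> 'x \<Rightarrow> 'a) \<Rightarrow> ('o \<times> 'o \<Rightarrow> 'x \<Rightarrow> 'a) \<Rightarrow> ('o \<times> 'o \<Rightarrow> 'a \<Rightarrow> 'x)
      \<Rightarrow> ('o \<times> 'o \<Rightarrow> 'x \<times> 'x \<Rightarrow> 'x) \<Rightarrow> bool" where
  "two_cell_structure D H d c i p \<longleftrightarrow>
     internal_category (prod_cat (op_cat D) D) H (hom_functor D) d c i p"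


section \<open>The category Bla(C)\<close>

text \<open>A four-tuple \<open>(B, R, m, e)\<close>; the ternary relation \<open>R\<close> is recorded as the object \<open>brel\<close> with
  its three projections.\<close>

record ('o, 'a) bla =
  bobj :: 'o
  brel :: 'o
  pr1 :: 'a
  pr2 :: 'a
  pr3 :: 'a
  bmul :: 'a
  bend :: 'a

definition factor_via :: "('o, 'a) cat \<Rightarrow> ('o, 'a) bla \<Rightarrow> 'a \<Rightarrow> 'a \<Rightarrow> 'a \<Rightarrow> 'a \<Rightarrow> bool" where
  "factor_via C \<beta> x y z w \<longleftrightarrow> w \<in> hom C (src C x) (brel \<beta>) \<and>
     pr1 \<beta> \<cdot>\<^bsub>C\<^esub> w = x \<and> pr2 \<beta> \<cdot>\<^bsub>C\<^esub> w = y \<and> pr3 \<beta> \<cdot>\<^bsub>C\<^esub> w = z"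

text \<open>\<open>\<langle>x, y, z\<rangle>\<close> factors through \<open>R\<close>.\<close>

definition factors :: "('o, 'a) cat \<Rightarrow> ('o, 'a) bla \<Rightarrow> 'a \<Rightarrow> 'a \<Rightarrow> 'a \<Rightarrow> bool" where
  "factors C \<beta> x y z \<longleftrightarrow> (\<exists>w. factor_via C \<beta> x y z w)"

text \<open>\<open>m\<langle>x, y, z\<rangle>\<close>; meaningful only when \<open>factors C \<beta> x y z\<close>.\<close>

definition mval :: "('o, 'a) cat \<Rightarrow> ('o, 'a) bla \<Rightarrow> 'a \<Rightarrow> 'a \<Rightarrow> 'a \<Rightarrow> 'a" where
  "mval C \<beta> x y z = bmul \<beta> \<cdot>\<^bsub>C\<^esub> (THE w. factor_via C \<beta> x y z w)"

definition ternary_relation :: "('o, 'a) cat \<Rightarrow> ('o, 'a) bla \<Rightarrow> bool" where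
  "ternary_relation C \<beta> \<longleftrightarrow> brel \<beta> \<in> Obj C \<and>
     pr1 \<beta> \<in> hom C (brel \<beta>) (bobj \<beta>) \<and> pr2 \<beta> \<in> hom C (brel \<beta>) (bobj \<beta>) \<and>
     pr3 \<beta> \<in> hom C (brel \<beta>) (bobj \<beta>) \<and>
     (\<forall>A\<in>Obj C. \<forall>w\<in>hom C A (brel \<beta>). \<forall>w'\<in>hom C A (brel \<beta>).
        pr1 \<beta> \<cdot>\<^bsub>C\<^esub> w = pr1 \<beta> \<cdot>\<^bsub>C\<^esub> w' \<and> pr2 \<beta> \<cdot>\<^bsub>C\<^esub> w = pr2 \<beta> \<cdot>\<^bsub>C\<^esub> w' \<and>
        pr3 \<beta> \<cdot>\<^bsub>C\<^esub> w = pr3 \<beta> \<cdot>\<^bsub>C\<^esub> w' \<longrightarrow> w = w')"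

definition bla_obj :: "('o, 'a) cat \<Rightarrow> ('o, 'a) bla \<Rightarrow> bool" where
  "bla_obj C \<beta> \<longleftrightarrow> bobj \<beta> \<in> Obj C \<and> ternary_relation C \<beta> \<and>
     bend \<beta> \<in> hom C (bobj \<beta>) (bobj \<beta>) \<and> bmul \<beta> \<in> hom C (brel \<beta>) (bobj \<beta>) \<and>
     (\<forall>A\<in>Obj C. \<forall>x\<in>hom C A (bobj \<beta>). \<forall>y\<in>hom C A (bobj \<beta>). \<forall>z\<in>hom C A (bobj \<beta>).
        factors C \<beta> x y (bend \<beta> \<cdot>\<^bsub>C\<^esub> y) \<and> factors C \<beta> (bend \<beta> \<cdot>\<^bsub>C\<^esub> y) y z \<longrightarrow>
        factors C \<beta> x y z) \<and>
     (\<forall>A\<in>Obj C. \<forall>x\<in>hom C A (bobj \<beta>).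
        factors C \<beta> (bend \<beta> \<cdot>\<^bsub>C\<^esub> x) x (bend \<beta> \<cdot>\<^bsub>C\<^esub> x))"

definition bla_mor :: "('o, 'a) cat \<Rightarrow> ('o, 'a) bla \<Rightarrow> ('o, 'a) bla \<Rightarrow> 'a \<Rightarrow> bool" where
  "bla_mor C \<beta> \<beta>' u \<longleftrightarrow> u \<in> hom C (bobj \<beta>) (bobj \<beta>') \<and>
     bend \<beta>' \<cdot>\<^bsub>C\<^esub> u = u \<cdot>\<^bsub>C\<^esub> bend \<beta> \<and>
     (\<forall>A\<in>Obj C. \<forall>x\<in>hom C A (bobj \<beta>). \<forall>y\<in>hom C A (bobj \<beta>). \<forall>z\<in>hom C A (bobj \<beta>).
        factors C \<beta> x y z \<longrightarrow>
        factors C \<beta>' (u \<cdot>\<^bsub>C\<^esub> x) (u \<cdot>\<^bsub>C\<^esub> y) (u \<cdot>\<^bsub>C\<^esub> z) \<and>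
        u \<cdot>\<^bsub>C\<^esub> mval C \<beta> x y z = mval C \<beta>' (u \<cdot>\<^bsub>C\<^esub> x) (u \<cdot>\<^bsub>C\<^esub> y) (u \<cdot>\<^bsub>C\<^esub> z))"

text \<open>An arrow of \<open>Bla(C)\<close> carries its source and target, since one arrow \<open>u\<close> of \<open>C\<close> may underlie
  morphisms between different structures.\<close>

definition Bla :: "('o, 'a) cat \<Rightarrow>
    (('o, 'a) bla, ('o, 'a) bla \<times> 'a \<times> ('o, 'a) bla) cat" where
  "Bla C = \<lparr>Obj = {\<beta>. bla_obj C \<beta>},
     Arr = {(\<beta>, u, \<beta>'). bla_obj C \<beta> \<and> bla_obj C \<beta>' \<and> bla_mor C \<beta> \<beta>' u},
     src = (\<lambda>(\<beta>, u, \<beta>'). \<beta>), tgt = (\<lambda>(\<beta>, u, \<beta>'). \<beta>'),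
     idn = (\<lambda>\<beta>. (\<beta>, idn C (bobj \<beta>), \<beta>)),
     cmp = (\<lambda>(\<beta>', v, \<beta>'') (\<beta>, u, _). (\<beta>, v \<cdot>\<^bsub>C\<^esub> u, \<beta>''))\<rparr>"

definition forget_Bla ::
    "(('o, 'a) bla, ('o, 'a) bla \<times> 'a \<times> ('o, 'a) bla, 'o, 'a) func" where
  "forget_Bla = \<lparr>omap = bobj, amap = (\<lambda>(\<beta>, u, \<beta>'). u)\<rparr>"


section \<open>The bifunctor of column vectors and its operations\<close>

text \<open>For \<open>B\<close> in the image of \<open>V\<close>, \<open>bla_at Cs V R B\<close> is \<open>R(B) = (B, R_B, m_B, e_B)\<close>, where \<open>B\<close> is
  identified with its unique preimage under \<open>V\<close>.\<close>

definition bla_at :: "('p, 'b) cat \<Rightarrow> ('p, 'b, 'o, 'a) func \<Rightarrow>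
    ('p, 'b, ('o, 'a) bla, ('o, 'a) bla \<times> 'a \<times> ('o, 'a) bla) func \<Rightarrow> 'o \<Rightarrow> ('o, 'a) bla" where
  "bla_at Cs V R B = omap R (THE B'. B' \<in> Obj Cs \<and> omap V B' = B)"

text \<open>A column vector with entries \<open>f\<close>, \<open>t\<close>, \<open>g\<close> is the triple \<open>(f, t, g)\<close>.  In the operations
  below, \<open>\<rho> B\<close> is the structure carried by \<open>B\<close>.\<close>

definition H_R :: "('o, 'a) cat \<Rightarrow> ('o \<Rightarrow> ('o, 'a) bla) \<Rightarrow>
    ('o \<times> 'o, 'a \<times> 'a, 'a \<times> 'a \<times> 'a) setfun" where
  "H_R C \<rho> = \<lparr>
     sobj = (\<lambda>(A, B). {(f, t, g). f \<in> hom C A B \<and> t \<in> hom C A B \<and> g \<in> hom C A B \<and>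
        factors C (\<rho> B) t f (bend (\<rho> B) \<cdot>\<^bsub>C\<^esub> f) \<and>
        factors C (\<rho> B) (bend (\<rho> B) \<cdot>\<^bsub>C\<^esub> g) g t}),
     sarr = (\<lambda>(v, u) (f, t, g). (u \<cdot>\<^bsub>C\<^esub> f \<cdot>\<^bsub>C\<^esub> v, u \<cdot>\<^bsub>C\<^esub> t \<cdot>\<^bsub>C\<^esub> v, u \<cdot>\<^bsub>C\<^esub> g \<cdot>\<^bsub>C\<^esub> v))\<rparr>"

definition vec_dom :: "'o \<times> 'o \<Rightarrow> 'a \<times> 'a \<times> 'a \<Rightarrow> 'a" where
  "vec_dom = (\<lambda>(A, B) (f, t, g). f)"

definition vec_cod :: "'o \<times> 'o \<Rightarrow> 'a \<times> 'a \<times> 'a \<Rightarrow> 'a" where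
  "vec_cod = (\<lambda>(A, B) (f, t, g). g)"

definition vec_zero :: "('o, 'a) cat \<Rightarrow> ('o \<Rightarrow> ('o, 'a) bla) \<Rightarrow> 'o \<times> 'o \<Rightarrow> 'a \<Rightarrow> 'a \<times> 'a \<times> 'a" where
  "vec_zero C \<rho> = (\<lambda>(A, B) f. (f, bend (\<rho> B) \<cdot>\<^bsub>C\<^esub> f, f))"

definition vec_plus :: "('o, 'a) cat \<Rightarrow> ('o \<Rightarrow> ('o, 'a) bla) \<Rightarrow> 'o \<times> 'o \<Rightarrow>
    ('a \<times> 'a \<times> 'a) \<times> ('a \<times> 'a \<times> 'a) \<Rightarrow> 'a \<times> 'a \<times> 'a" where
  "vec_plus C \<rho> = (\<lambda>(A, B) ((_, t', h), (f, t, g)). (f, mval C (\<rho> B) t' g t, h))"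

end

theory Submission
  imports Defs
begin

text \<open>
  The operations on column vectors are given by fixed formulas, so a family \<open>H\<close> of sets of
  column vectors can fail to be a 2-cell structure in two ways only: an operation may lead
  outside its prescribed target, or the unit or associativity law may fail.  The closure
  conditions say that the action, the domain and codomain, the zeros and the sums land where
  they should; the remaining conditions are the unit and associativity laws read off in the
  middle entry, the outer entries agreeing by construction.  Hence a 2-cell structure satisfies
  all the conditions by mere unfolding (\<open>two_cell_structureD\<close>).

  For the converse (\<open>two_cell_structureI\<close>) every other axiom must hold automatically.
  Functoriality of the action is associativity and unitality of composition in \<open>C\<close>, and the
  domain and codomain of zeros and sums are right by construction.  What has content is
  naturality of the zero and of the sum.  In the variable \<open>B\<close> it amounts to the morphisms of the
  subcategory commuting with \<open>e\<close> and with \<open>m\<close>, which they do because the section \<open>R\<close> makes each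
  of them underlie a morphism of \<open>Bla(C)\<close> (\<open>section_bla_mor\<close>).  In the variable \<open>A\<close> it amounts
  to \<open>m\<langle>x, y, z\<rangle>v = m\<langle>xv, yv, zv\<rangle>\<close>, which follows from joint monicity of the projections of
  the relation (\<open>mval_comp\<close>).  Both facts about the sum presuppose that \<open>m\<langle>t', g, t\<rangle>\<close> is
  defined: the two vectors put \<open>\<langle>t', g, eg\<rangle>\<close> and \<open>\<langle>eg, g, t\<rangle>\<close> in the relation, and the
  first axiom of \<open>Bla(C)\<close> joins them to \<open>\<langle>t', g, t\<rangle>\<close> (\<open>composable_factors\<close>).
\<close>

section \<open>Composition in a category\<close>

lemma hom_iff: "f \<in> hom C A B \<longleftrightarrow> f \<in> Arr C \<and> src C f = A \<and> tgt C f = B"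
  by (simp add: hom_def)

lemma hom_Obj:
  assumes "category C" "f \<in> hom C A B"
  shows "A \<in> Obj C" "B \<in> Obj C"
  using assms unfolding category_def hom_def by auto

lemma cmp_hom:
  assumes "category C" "f \<in> hom C A B" "g \<in> hom C B E"
  shows "g \<cdot>\<^bsub>C\<^esub> f \<in> hom C A E"
  using assms unfolding category_def hom_def by auto

lemma cmp_assoc:
  assumes "category C" "f \<in> hom C A B" "g \<in> hom C B E" "h \<in> hom C E F"
  shows "(h \<cdot>\<^bsub>C\<^esub> g) \<cdot>\<^bsub>C\<^esub> f = h \<cdot>\<^bsub>C\<^esub> (g \<cdot>\<^bsub>C\<^esub> f)"
  using assms unfolding category_def hom_def by auto

lemma cmp_idn:
  assumes "category C" "f \<in> hom C A B"
  shows "f \<cdot>\<^bsub>C\<^esub> idn C A = f" "idn C B \<cdot>\<^bsub>C\<^esub> f = f"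
  using assms unfolding category_def hom_def by auto

lemma sandwich_hom:
  assumes "category C" "f \<in> hom C A B" "u \<in> hom C B B'" "v \<in> hom C A' A"
  shows "u \<cdot>\<^bsub>C\<^esub> f \<cdot>\<^bsub>C\<^esub> v \<in> hom C A' B'"
  using assms by (blast intro: cmp_hom)

lemma sandwich_idn:
  assumes "category C" "f \<in> hom C A B"
  shows "idn C B \<cdot>\<^bsub>C\<^esub> f \<cdot>\<^bsub>C\<^esub> idn C A = f"
  using assms by (simp add: cmp_idn)

lemma sandwich_sandwich:
  assumes C: "category C" and f: "f \<in> hom C A B"
    and u: "u \<in> hom C B B'" "u' \<in> hom C B' B''"
    and v: "v \<in> hom C A' A" "v' \<in> hom C A'' A'"
  shows "(u' \<cdot>\<^bsub>C\<^esub> u) \<cdot>\<^bsub>C\<^esub> f \<cdot>\<^bsub>C\<^esub> (v \<cdot>\<^bsub>C\<^esub> v') = u' \<cdot>\<^bsub>C\<^esub> (u \<cdot>\<^bsub>C\<^esub> f \<cdot>\<^bsub>C\<^esub> v) \<cdot>\<^bsub>C\<^esub> v'"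
proof -
  note uf = cmp_hom[OF C f u(1)] and uuf = cmp_hom[OF C cmp_hom[OF C f u(1)] u(2)]
  have "(u' \<cdot>\<^bsub>C\<^esub> u) \<cdot>\<^bsub>C\<^esub> f \<cdot>\<^bsub>C\<^esub> (v \<cdot>\<^bsub>C\<^esub> v') = (u' \<cdot>\<^bsub>C\<^esub> (u \<cdot>\<^bsub>C\<^esub> f)) \<cdot>\<^bsub>C\<^esub> v \<cdot>\<^bsub>C\<^esub> v'"
    using cmp_assoc[OF C f u] cmp_assoc[OF C v(2,1) uuf] by simp
  also have "\<dots> = u' \<cdot>\<^bsub>C\<^esub> (u \<cdot>\<^bsub>C\<^esub> f \<cdot>\<^bsub>C\<^esub> v) \<cdot>\<^bsub>C\<^esub> v'"
    using cmp_assoc[OF C v(1) uf u(2)] by simp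
  finally show ?thesis .
qed


section \<open>Ternary relations and the partial operation \<open>m\<close>\<close>

lemma factor_via_mval:
  assumes "ternary_relation C \<beta>" "category C" "factor_via C \<beta> x y z w"
  shows "mval C \<beta> x y z = bmul \<beta> \<cdot>\<^bsub>C\<^esub> w"
proof -
  have "src C x \<in> Obj C"
    using assms(2,3) hom_Obj(1)[of C w] unfolding factor_via_def by auto
  then have "w' = w" if "factor_via C \<beta> x y z w'" for w'
    using assms that unfolding ternary_relation_def factor_via_def by metis
  then have "(THE w. factor_via C \<beta> x y z w) = w"
    using assms(3) by blast
  then show ?thesis by (simp add: mval_def)
qed

text \<open>If \<open>w\<close> factors \<open>\<langle>x, y, z\<rangle>\<close> through the relation then \<open>wv\<close> factors \<open>\<langle>xv, yv, zv\<rangle>\<close>; since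
  factorizations are unique, the value of \<open>m\<close> at \<open>\<langle>xv, yv, zv\<rangle>\<close> is computed by \<open>wv\<close>.\<close>

lemma mval_comp:
  assumes \<beta>: "bla_obj C \<beta>" and C: "category C" and fac: "factors C \<beta> x y z"
    and x: "x \<in> hom C A B" and v: "v \<in> hom C A' A"
  shows "factors C \<beta> (x \<cdot>\<^bsub>C\<^esub> v) (y \<cdot>\<^bsub>C\<^esub> v) (z \<cdot>\<^bsub>C\<^esub> v)"
    and "mval C \<beta> x y z \<cdot>\<^bsub>C\<^esub> v = mval C \<beta> (x \<cdot>\<^bsub>C\<^esub> v) (y \<cdot>\<^bsub>C\<^esub> v) (z \<cdot>\<^bsub>C\<^esub> v)"
proof -
  have rel: "ternary_relation C \<beta>" using \<beta> by (simp add: bla_obj_def)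
  have pr: "pr1 \<beta> \<in> hom C (brel \<beta>) (bobj \<beta>)" "pr2 \<beta> \<in> hom C (brel \<beta>) (bobj \<beta>)"
    "pr3 \<beta> \<in> hom C (brel \<beta>) (bobj \<beta>)" "bmul \<beta> \<in> hom C (brel \<beta>) (bobj \<beta>)"
    using \<beta> by (auto simp: bla_obj_def ternary_relation_def)
  obtain w where w: "factor_via C \<beta> x y z w"
    using fac by (auto simp: factors_def)
  then have wh: "w \<in> hom C A (brel \<beta>)"
    using x by (simp add: factor_via_def hom_iff)
  have "src C (x \<cdot>\<^bsub>C\<^esub> v) = A'" using cmp_hom[OF C v x] by (simp add: hom_iff)
  then have wv: "factor_via C \<beta> (x \<cdot>\<^bsub>C\<^esub> v) (y \<cdot>\<^bsub>C\<^esub> v) (z \<cdot>\<^bsub>C\<^esub> v) (w \<cdot>\<^bsub>C\<^esub> v)"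
    using w cmp_hom[OF C v wh] pr[THEN cmp_assoc[OF C v wh]] by (auto simp: factor_via_def)
  then show "factors C \<beta> (x \<cdot>\<^bsub>C\<^esub> v) (y \<cdot>\<^bsub>C\<^esub> v) (z \<cdot>\<^bsub>C\<^esub> v)"
    by (auto simp: factors_def)
  show "mval C \<beta> x y z \<cdot>\<^bsub>C\<^esub> v = mval C \<beta> (x \<cdot>\<^bsub>C\<^esub> v) (y \<cdot>\<^bsub>C\<^esub> v) (z \<cdot>\<^bsub>C\<^esub> v)"
    using factor_via_mval[OF rel C w] factor_via_mval[OF rel C wv] cmp_assoc[OF C v wh pr(4)]
    by simp
qed

lemma mval_sandwich:
  assumes C: "category C" and \<beta>: "bla_obj C \<beta>" "bla_obj C \<beta>'" and u: "bla_mor C \<beta> \<beta>' u"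
    and fac: "factors C \<beta> x y z"
    and xyz: "x \<in> hom C A (bobj \<beta>)" "y \<in> hom C A (bobj \<beta>)" "z \<in> hom C A (bobj \<beta>)"
    and v: "v \<in> hom C A' A"
  shows "u \<cdot>\<^bsub>C\<^esub> mval C \<beta> x y z \<cdot>\<^bsub>C\<^esub> v =
    mval C \<beta>' (u \<cdot>\<^bsub>C\<^esub> x \<cdot>\<^bsub>C\<^esub> v) (u \<cdot>\<^bsub>C\<^esub> y \<cdot>\<^bsub>C\<^esub> v) (u \<cdot>\<^bsub>C\<^esub> z \<cdot>\<^bsub>C\<^esub> v)"
proof -
  have "A \<in> Obj C" using hom_Obj[OF C v] by simp
  then have "factors C \<beta>' (u \<cdot>\<^bsub>C\<^esub> x) (u \<cdot>\<^bsub>C\<^esub> y) (u \<cdot>\<^bsub>C\<^esub> z)"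
    and "u \<cdot>\<^bsub>C\<^esub> mval C \<beta> x y z = mval C \<beta>' (u \<cdot>\<^bsub>C\<^esub> x) (u \<cdot>\<^bsub>C\<^esub> y) (u \<cdot>\<^bsub>C\<^esub> z)"
    and "u \<cdot>\<^bsub>C\<^esub> x \<in> hom C A (bobj \<beta>')"
    using u xyz fac cmp_hom[OF C] unfolding bla_mor_def by blast+
  then show ?thesis using mval_comp(2)[OF \<beta>(2) C _ _ v] by simp
qed

lemma bend_sandwich:
  assumes C: "category C" and \<beta>: "bla_obj C \<beta>" "bla_obj C \<beta>'" and u: "bla_mor C \<beta> \<beta>' u"
    and f: "f \<in> hom C A (bobj \<beta>)" and v: "v \<in> hom C A' A"
  shows "u \<cdot>\<^bsub>C\<^esub> (bend \<beta> \<cdot>\<^bsub>C\<^esub> f) \<cdot>\<^bsub>C\<^esub> v = bend \<beta>' \<cdot>\<^bsub>C\<^esub> (u \<cdot>\<^bsub>C\<^esub> f \<cdot>\<^bsub>C\<^esub> v)"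
proof -
  have e: "bend \<beta> \<in> hom C (bobj \<beta>) (bobj \<beta>)" "bend \<beta>' \<in> hom C (bobj \<beta>') (bobj \<beta>')"
    and uh: "u \<in> hom C (bobj \<beta>) (bobj \<beta>')" and ue: "bend \<beta>' \<cdot>\<^bsub>C\<^esub> u = u \<cdot>\<^bsub>C\<^esub> bend \<beta>"
    using \<beta> u by (auto simp: bla_obj_def bla_mor_def)
  have "u \<cdot>\<^bsub>C\<^esub> (bend \<beta> \<cdot>\<^bsub>C\<^esub> f) = bend \<beta>' \<cdot>\<^bsub>C\<^esub> (u \<cdot>\<^bsub>C\<^esub> f)"
    using cmp_assoc[OF C f e(1) uh] cmp_assoc[OF C f uh e(2)] ue by simp
  then show ?thesis using cmp_assoc[OF C v cmp_hom[OF C f uh] e(2)] by simp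
qed


section \<open>2-cell structures of column vectors over a subcategory\<close>

text \<open>What the factorization of the forgetful functor contributes to the argument is a subcategory
  \<open>D\<close> of \<open>C\<close> together with a structure \<open>\<rho> B\<close> on each of its objects for
  which every morphism of \<open>D\<close> is a morphism of \<open>Bla(C)\<close>.\<close>

locale structured_subcategory =
  fixes C D :: "('o, 'a) cat" and \<rho> :: "'o \<Rightarrow> ('o, 'a) bla"
  assumes C: "category C" and D: "category D"
    and Arr_sub: "Arr D \<subseteq> Arr C"
    and src_D: "src D = src C" and tgt_D: "tgt D = tgt C"
    and idn_D: "idn D = idn C" and cmp_D: "cmp D = cmp C"
    and \<rho>_obj: "B \<in> Obj D \<Longrightarrow> bla_obj C (\<rho> B)"
    and \<rho>_carrier: "B \<in> Obj D \<Longrightarrow> bobj (\<rho> B) = B"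
    and \<rho>_mor: "u \<in> hom D B B' \<Longrightarrow> bla_mor C (\<rho> B) (\<rho> B') u"
begin

lemma hom_sub: "f \<in> hom D A B \<Longrightarrow> f \<in> hom C A B"
  using Arr_sub by (auto simp: hom_iff src_D tgt_D)

lemma H_R_iff:
  "(f, t, g) \<in> sobj (H_R C \<rho>) (A, B) \<longleftrightarrow>
     f \<in> hom C A B \<and> t \<in> hom C A B \<and> g \<in> hom C A B \<and>
     factors C (\<rho> B) t f (bend (\<rho> B) \<cdot>\<^bsub>C\<^esub> f) \<and>
     factors C (\<rho> B) (bend (\<rho> B) \<cdot>\<^bsub>C\<^esub> g) g t"
  by (simp add: H_R_def)

text \<open>The value \<open>m\<langle>t', g, t\<rangle>\<close> in a sum is meaningful because the shared entry \<open>g\<close> lets the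
  first axiom of \<open>Bla(C)\<close> join \<open>\<langle>t', g, eg\<rangle>\<close> and \<open>\<langle>eg, g, t\<rangle>\<close>.\<close>

lemma composable_factors:
  assumes B: "B \<in> Obj D"
    and x': "(g, t', h) \<in> sobj (H_R C \<rho>) (A, B)" and x: "(f, t, g) \<in> sobj (H_R C \<rho>) (A, B)"
  shows "factors C (\<rho> B) t' g t"
proof -
  have "A \<in> Obj C" using x hom_Obj[OF C] by (auto simp: H_R_iff)
  then show ?thesis
    using \<rho>_obj[OF B] \<rho>_carrier[OF B] x x' unfolding bla_obj_def H_R_iff by metis
qed

abbreviation index_cat :: "('o \<times> 'o, 'a \<times> 'a) cat" where
  "index_cat \<equiv> prod_cat (op_cat D) D"

abbreviation vec_functor ::
    "('o \<Rightarrow> 'o \<Rightarrow> ('a \<times> 'a \<times> 'a) set) \<Rightarrow> ('o \<times> 'o, 'a \<times> 'a, 'a \<times> 'a \<times> 'a) setfun" where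
  "vec_functor H \<equiv> \<lparr>sobj = (\<lambda>(A, B). H A B), sarr = sarr (H_R C \<rho>)\<rparr>"

lemma index_cat_sel:
  "Obj index_cat = Obj D \<times> Obj D" "Arr index_cat = Arr D \<times> Arr D"
  "src index_cat (v, u) = (tgt C v, src C u)" "tgt index_cat (v, u) = (src C v, tgt C u)"
  "idn index_cat (A, B) = (idn C A, idn C B)"
  "(v', u') \<cdot>\<^bsub>index_cat\<^esub> (v, u) = (v \<cdot>\<^bsub>C\<^esub> v', u' \<cdot>\<^bsub>C\<^esub> u)"
  by (simp_all add: prod_cat_def op_cat_def src_D tgt_D idn_D cmp_D)

text \<open>An arrow of \<open>D\<^sup>o\<^sup>p \<times> D\<close> is a pair \<open>(v, u)\<close> in which \<open>v\<close> is reversed, so a quantification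
  over arrows of the index category is one over \<open>v \<in> hom D A' A\<close> and \<open>u \<in> hom D B B'\<close>.\<close>

lemma set_functor_index_iff:
  "set_functor index_cat F \<longleftrightarrow>
     (\<forall>A A' B B'. \<forall>v\<in>hom D A' A. \<forall>u\<in>hom D B B'. \<forall>x\<in>sobj F (A, B).
        sarr F (v, u) x \<in> sobj F (A', B')) \<and>
     (\<forall>A\<in>Obj D. \<forall>B\<in>Obj D. \<forall>x\<in>sobj F (A, B). sarr F (idn C A, idn C B) x = x) \<and>
     (\<forall>A A' A'' B B' B''. \<forall>v\<in>hom D A' A. \<forall>u\<in>hom D B B'. \<forall>v'\<in>hom D A'' A'. \<forall>u'\<in>hom D B' B''.
        \<forall>x\<in>sobj F (A, B). sarr F (v \<cdot>\<^bsub>C\<^esub> v', u' \<cdot>\<^bsub>C\<^esub> u) x = sarr F (v', u') (sarr F (v, u) x))"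
  unfolding set_functor_def
  by (auto simp: index_cat_sel hom_iff src_D tgt_D)

lemma nat_trans_index_iff:
  "nat_trans index_cat F G \<tau> \<longleftrightarrow> set_functor index_cat F \<and> set_functor index_cat G \<and>
     (\<forall>A\<in>Obj D. \<forall>B\<in>Obj D. \<forall>x\<in>sobj F (A, B). \<tau> (A, B) x \<in> sobj G (A, B)) \<and>
     (\<forall>A A' B B'. \<forall>v\<in>hom D A' A. \<forall>u\<in>hom D B B'. \<forall>x\<in>sobj F (A, B).
        \<tau> (A', B') (sarr F (v, u) x) = sarr G (v, u) (\<tau> (A, B) x))"
  unfolding nat_trans_def
  by (auto simp: index_cat_sel hom_iff src_D tgt_D)

lemma set_functor_closed:
  assumes "set_functor index_cat F" "v \<in> hom D A' A" "u \<in> hom D B B'" "x \<in> sobj F (A, B)"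
  shows "sarr F (v, u) x \<in> sobj F (A', B')"
  using assms(1)[unfolded set_functor_index_iff, THEN conjunct1] assms(2-4) by blast

lemma nat_trans_closed:
  assumes "nat_trans index_cat F G \<tau>" "A \<in> Obj D" "B \<in> Obj D" "x \<in> sobj F (A, B)"
  shows "\<tau> (A, B) x \<in> sobj G (A, B)"
  using assms(1) unfolding nat_trans_index_iff using assms(2-4) by blast

lemma set_functor_hom: "set_functor index_cat (hom_functor D)"
  unfolding set_functor_index_iff
  using sandwich_hom[OF D] sandwich_idn[OF D] sandwich_sandwich[OF D]
  by (auto simp: hom_functor_def cmp_D idn_D)

end

locale vector_family = structured_subcategory C D \<rho>
  for C D :: "('o, 'a) cat" and \<rho> :: "'o \<Rightarrow> ('o, 'a) bla" +
  fixes H :: "'o \<Rightarrow> 'o \<Rightarrow> ('a \<times> 'a \<times> 'a) set"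
  assumes H_sub: "A \<in> Obj D \<Longrightarrow> B \<in> Obj D \<Longrightarrow> H A B \<subseteq> sobj (H_R C \<rho>) (A, B)"
begin

lemma H_entries:
  assumes "A \<in> Obj D" "B \<in> Obj D" "(f, t, g) \<in> H A B"
  shows "f \<in> hom C A B" "t \<in> hom C A B" "g \<in> hom C A B"
  using assms H_sub[of A B] H_R_iff[of f t g A B] by auto

text \<open>Sandwiching respects identities and composites on all arrows of \<open>C\<close>, so a family closed
  under it carries a functor.\<close>

lemma set_functor_vec:
  assumes action: "\<And>A A' B B' f t g u v. (f, t, g) \<in> H A B \<Longrightarrow>
      u \<in> hom D B B' \<Longrightarrow> v \<in> hom D A' A \<Longrightarrow>
      (u \<cdot>\<^bsub>C\<^esub> f \<cdot>\<^bsub>C\<^esub> v, u \<cdot>\<^bsub>C\<^esub> t \<cdot>\<^bsub>C\<^esub> v, u \<cdot>\<^bsub>C\<^esub> g \<cdot>\<^bsub>C\<^esub> v) \<in> H A' B'"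
  shows "set_functor index_cat (vec_functor H)"
proof -
  have comp: "(u' \<cdot>\<^bsub>C\<^esub> u) \<cdot>\<^bsub>C\<^esub> k \<cdot>\<^bsub>C\<^esub> (v \<cdot>\<^bsub>C\<^esub> v') = u' \<cdot>\<^bsub>C\<^esub> (u \<cdot>\<^bsub>C\<^esub> k \<cdot>\<^bsub>C\<^esub> v) \<cdot>\<^bsub>C\<^esub> v'"
    if "k \<in> hom C A B" "v \<in> hom D A' A" "u \<in> hom D B B'" "v' \<in> hom D A'' A'"
      "u' \<in> hom D B' B''" for k u u' v v' A A' A'' B B' B''
    using that by (blast intro: sandwich_sandwich[OF C] hom_sub)
  have unit: "idn C B \<cdot>\<^bsub>C\<^esub> k \<cdot>\<^bsub>C\<^esub> idn C A = k" if "k \<in> hom C A B" for k A B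
    using that by (rule sandwich_idn[OF C])
  show ?thesis
    unfolding set_functor_index_iff
  proof (intro conjI allI ballI, goal_cases closed identity composition)
    case closed
    then show ?case using action by (auto simp: H_R_def split: prod.split)
  next
    case identity
    then show ?case using unit H_entries by (auto simp: H_R_def split: prod.split)
  next
    case (composition A A' A'' B B' B'' v u v' u' x)
    obtain f t g where x: "x = (f, t, g)" by (cases x)
    have "A \<in> Obj D" "B \<in> Obj D"
      using composition(1,2) hom_Obj[OF D] by auto
    then show ?case
      using composition comp H_entries[of A B f t g] by (simp add: x H_R_def)
  qed
qed

lemma two_cell_structureD:
  assumes "two_cell_structure D (vec_functor H) vec_dom vec_cod (vec_zero C \<rho>) (vec_plus C \<rho>)"
    and A: "A \<in> Obj D" and B: "B \<in> Obj D"
  shows "\<lbrakk>(f, t, g) \<in> H A B; u \<in> hom D B B'; v \<in> hom D A' A\<rbrakk> \<Longrightarrow>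
      (u \<cdot>\<^bsub>C\<^esub> f \<cdot>\<^bsub>C\<^esub> v, u \<cdot>\<^bsub>C\<^esub> t \<cdot>\<^bsub>C\<^esub> v, u \<cdot>\<^bsub>C\<^esub> g \<cdot>\<^bsub>C\<^esub> v) \<in> H A' B'"
    and "(f, t, g) \<in> H A B \<Longrightarrow> f \<in> Arr D \<and> g \<in> Arr D"
    and "f \<in> hom D A B \<Longrightarrow> (f, bend (\<rho> B) \<cdot>\<^bsub>C\<^esub> f, f) \<in> H A B"
    and "\<lbrakk>(g, t', h) \<in> H A B; (f, t, g) \<in> H A B\<rbrakk> \<Longrightarrow>
      (f, mval C (\<rho> B) t' g t, h) \<in> H A B"
    and "(f, t, g) \<in> H A B \<Longrightarrow> mval C (\<rho> B) t f (bend (\<rho> B) \<cdot>\<^bsub>C\<^esub> f) = t"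
    and "(f, t, g) \<in> H A B \<Longrightarrow> mval C (\<rho> B) (bend (\<rho> B) \<cdot>\<^bsub>C\<^esub> g) g t = t"
    and "\<lbrakk>(h, t'', k) \<in> H A B; (g, t', h) \<in> H A B; (f, t, g) \<in> H A B\<rbrakk> \<Longrightarrow>
      mval C (\<rho> B) t'' h (mval C (\<rho> B) t' g t) = mval C (\<rho> B) (mval C (\<rho> B) t'' h t') g t"
proof -
  have dom: "nat_trans index_cat (vec_functor H) (hom_functor D) vec_dom"
    and cod: "nat_trans index_cat (vec_functor H) (hom_functor D) vec_cod"
    and zero: "nat_trans index_cat (hom_functor D) (vec_functor H) (vec_zero C \<rho>)"
    and plus: "nat_trans index_cat
      (pullback_functor (vec_functor H) (vec_functor H) vec_dom vec_cod) (vec_functor H)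
      (vec_plus C \<rho>)"
    and unit: "\<And>x. x \<in> H A B \<Longrightarrow>
      vec_plus C \<rho> (A, B) (x, vec_zero C \<rho> (A, B) (vec_dom (A, B) x)) = x \<and>
      vec_plus C \<rho> (A, B) (vec_zero C \<rho> (A, B) (vec_cod (A, B) x), x) = x"
    and assoc: "\<And>x'' x' x. \<lbrakk>x'' \<in> H A B; x' \<in> H A B; x \<in> H A B;
        vec_dom (A, B) x'' = vec_cod (A, B) x'; vec_dom (A, B) x' = vec_cod (A, B) x\<rbrakk> \<Longrightarrow>
      vec_plus C \<rho> (A, B) (x'', vec_plus C \<rho> (A, B) (x', x)) =
      vec_plus C \<rho> (A, B) (vec_plus C \<rho> (A, B) (x'', x'), x)"
    using assms unfolding two_cell_structure_def internal_category_def
    by (simp_all add: index_cat_sel)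
  note vec_defs = vec_dom_def vec_cod_def vec_zero_def vec_plus_def
  have vec: "set_functor index_cat (vec_functor H)"
    using dom by (simp add: nat_trans_def)
  show "(u \<cdot>\<^bsub>C\<^esub> f \<cdot>\<^bsub>C\<^esub> v, u \<cdot>\<^bsub>C\<^esub> t \<cdot>\<^bsub>C\<^esub> v, u \<cdot>\<^bsub>C\<^esub> g \<cdot>\<^bsub>C\<^esub> v) \<in> H A' B'"
    if "(f, t, g) \<in> H A B" "u \<in> hom D B B'" "v \<in> hom D A' A"
    using set_functor_closed[OF vec that(3,2), of "(f, t, g)"] that(1) by (simp add: H_R_def)
  show "f \<in> Arr D \<and> g \<in> Arr D" if "(f, t, g) \<in> H A B"
    using nat_trans_closed[OF dom A B, of "(f, t, g)"] nat_trans_closed[OF cod A B, of "(f, t, g)"]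
      that by (simp add: hom_functor_def hom_iff vec_defs)
  show "(f, bend (\<rho> B) \<cdot>\<^bsub>C\<^esub> f, f) \<in> H A B" if "f \<in> hom D A B"
    using nat_trans_closed[OF zero A B, of f] that by (simp add: hom_functor_def vec_defs)
  show "(f, mval C (\<rho> B) t' g t, h) \<in> H A B" if "(g, t', h) \<in> H A B" "(f, t, g) \<in> H A B"
    using nat_trans_closed[OF plus A B, of "((g, t', h), (f, t, g))"] that
    by (simp add: pullback_functor_def vec_defs)
  show "mval C (\<rho> B) t f (bend (\<rho> B) \<cdot>\<^bsub>C\<^esub> f) = t"
    "mval C (\<rho> B) (bend (\<rho> B) \<cdot>\<^bsub>C\<^esub> g) g t = t" if "(f, t, g) \<in> H A B"
    using unit[OF that] by (simp_all add: vec_defs)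
  show "mval C (\<rho> B) t'' h (mval C (\<rho> B) t' g t) = mval C (\<rho> B) (mval C (\<rho> B) t'' h t') g t"
    if "(h, t'', k) \<in> H A B" "(g, t', h) \<in> H A B" "(f, t, g) \<in> H A B"
    using assoc[OF that] by (simp add: vec_defs)
qed

text \<open>The two naturality squares that use the structure morphisms \<open>e\<close> and \<open>m\<close>.\<close>

lemma vec_zero_natural:
  assumes u: "u \<in> hom D B B'" and v: "v \<in> hom D A' A" and f: "f \<in> hom D A B"
  shows "vec_zero C \<rho> (A', B') (u \<cdot>\<^bsub>C\<^esub> f \<cdot>\<^bsub>C\<^esub> v) =
    sarr (H_R C \<rho>) (v, u) (vec_zero C \<rho> (A, B) f)"
proof -
  have B: "B \<in> Obj D" "B' \<in> Obj D" using hom_Obj[OF D u] by auto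
  have "u \<cdot>\<^bsub>C\<^esub> (bend (\<rho> B) \<cdot>\<^bsub>C\<^esub> f) \<cdot>\<^bsub>C\<^esub> v = bend (\<rho> B') \<cdot>\<^bsub>C\<^esub> (u \<cdot>\<^bsub>C\<^esub> f \<cdot>\<^bsub>C\<^esub> v)"
    using B hom_sub f v by (intro bend_sandwich[OF C \<rho>_obj \<rho>_obj \<rho>_mor[OF u]]) (auto simp: \<rho>_carrier)
  then show ?thesis by (simp add: vec_zero_def H_R_def)
qed

lemma vec_plus_natural:
  assumes u: "u \<in> hom D B B'" and v: "v \<in> hom D A' A"
    and x': "(g, t', h) \<in> H A B" and x: "(f, t, g) \<in> H A B"
  shows "vec_plus C \<rho> (A', B')
      (sarr (H_R C \<rho>) (v, u) (g, t', h), sarr (H_R C \<rho>) (v, u) (f, t, g)) =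
    sarr (H_R C \<rho>) (v, u) (vec_plus C \<rho> (A, B) ((g, t', h), (f, t, g)))"
proof -
  have A: "A \<in> Obj D" and B: "B \<in> Obj D" "B' \<in> Obj D"
    using hom_Obj[OF D u] hom_Obj[OF D v] by auto
  have fac: "factors C (\<rho> B) t' g t"
    using composable_factors[OF B(1)] H_sub[OF A B(1)] x x' by blast
  have "u \<cdot>\<^bsub>C\<^esub> mval C (\<rho> B) t' g t \<cdot>\<^bsub>C\<^esub> v =
      mval C (\<rho> B') (u \<cdot>\<^bsub>C\<^esub> t' \<cdot>\<^bsub>C\<^esub> v) (u \<cdot>\<^bsub>C\<^esub> g \<cdot>\<^bsub>C\<^esub> v) (u \<cdot>\<^bsub>C\<^esub> t \<cdot>\<^bsub>C\<^esub> v)"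
    using B H_entries[OF A B(1) x] H_entries[OF A B(1) x'] hom_sub[OF v]
    by (intro mval_sandwich[OF C \<rho>_obj \<rho>_obj \<rho>_mor[OF u] fac]) (auto simp: \<rho>_carrier)
  then show ?thesis by (simp add: vec_plus_def H_R_def)
qed

lemma two_cell_structureI:
  assumes action: "\<And>A A' B B' f t g u v. (f, t, g) \<in> H A B \<Longrightarrow>
      u \<in> hom D B B' \<Longrightarrow> v \<in> hom D A' A \<Longrightarrow>
      (u \<cdot>\<^bsub>C\<^esub> f \<cdot>\<^bsub>C\<^esub> v, u \<cdot>\<^bsub>C\<^esub> t \<cdot>\<^bsub>C\<^esub> v, u \<cdot>\<^bsub>C\<^esub> g \<cdot>\<^bsub>C\<^esub> v) \<in> H A' B'"
    and ends: "\<And>A B f t g. \<lbrakk>A \<in> Obj D; B \<in> Obj D; (f, t, g) \<in> H A B\<rbrakk> \<Longrightarrow>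
      f \<in> Arr D \<and> g \<in> Arr D"
    and zeros: "\<And>A B f. f \<in> hom D A B \<Longrightarrow> (f, bend (\<rho> B) \<cdot>\<^bsub>C\<^esub> f, f) \<in> H A B"
    and sums: "\<And>A B f t g t' h. \<lbrakk>A \<in> Obj D; B \<in> Obj D; (g, t', h) \<in> H A B; (f, t, g) \<in> H A B\<rbrakk> \<Longrightarrow>
      (f, mval C (\<rho> B) t' g t, h) \<in> H A B"
    and units: "\<And>A B f t g. \<lbrakk>A \<in> Obj D; B \<in> Obj D; (f, t, g) \<in> H A B\<rbrakk> \<Longrightarrow>
      mval C (\<rho> B) t f (bend (\<rho> B) \<cdot>\<^bsub>C\<^esub> f) = t \<and>
      mval C (\<rho> B) (bend (\<rho> B) \<cdot>\<^bsub>C\<^esub> g) g t = t"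
    and assoc: "\<And>A B f t g t' h t'' k. \<lbrakk>A \<in> Obj D; B \<in> Obj D;
        (h, t'', k) \<in> H A B; (g, t', h) \<in> H A B; (f, t, g) \<in> H A B\<rbrakk> \<Longrightarrow>
      mval C (\<rho> B) t'' h (mval C (\<rho> B) t' g t) = mval C (\<rho> B) (mval C (\<rho> B) t'' h t') g t"
  shows "two_cell_structure D (vec_functor H) vec_dom vec_cod (vec_zero C \<rho>) (vec_plus C \<rho>)"
proof -
  let ?P = "pullback_functor (vec_functor H) (vec_functor H) vec_dom vec_cod"
  note vec_defs = vec_dom_def vec_cod_def vec_zero_def vec_plus_def
  have vec: "set_functor index_cat (vec_functor H)"
    using action by (rule set_functor_vec)
  have ends_hom: "f \<in> hom D A B" "g \<in> hom D A B"
    if "A \<in> Obj D" "B \<in> Obj D" "(f, t, g) \<in> H A B" for A B f t g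
    using ends[OF that] H_entries[OF that] by (auto simp: hom_iff src_D tgt_D)
  have pull: "set_functor index_cat ?P"
    using vec unfolding set_functor_index_iff
    by (auto simp: pullback_functor_def vec_defs H_R_def)
  have dom: "nat_trans index_cat (vec_functor H) (hom_functor D) vec_dom"
    unfolding nat_trans_index_iff using vec set_functor_hom ends_hom
    by (auto simp: hom_functor_def vec_defs H_R_def cmp_D)
  have cod: "nat_trans index_cat (vec_functor H) (hom_functor D) vec_cod"
    unfolding nat_trans_index_iff using vec set_functor_hom ends_hom
    by (auto simp: hom_functor_def vec_defs H_R_def cmp_D)
  have zero: "nat_trans index_cat (hom_functor D) (vec_functor H) (vec_zero C \<rho>)"
    unfolding nat_trans_index_iff
    using vec set_functor_hom zeros vec_zero_natural
    by (auto simp: hom_functor_def cmp_D) (auto simp: vec_zero_def)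
  have plus_closed: "vec_plus C \<rho> (A, B) x \<in> H A B"
    if "A \<in> Obj D" "B \<in> Obj D" "x \<in> sobj ?P (A, B)" for A B x
    using that sums by (auto simp: pullback_functor_def vec_defs)
  have plus_natural: "vec_plus C \<rho> (A', B') (sarr ?P (v, u) x) =
      sarr (H_R C \<rho>) (v, u) (vec_plus C \<rho> (A, B) x)"
    if "v \<in> hom D A' A" "u \<in> hom D B B'" "x \<in> sobj ?P (A, B)" for A A' B B' u v x
    using that vec_plus_natural by (auto simp: pullback_functor_def vec_dom_def vec_cod_def)
  have plus: "nat_trans index_cat ?P (vec_functor H) (vec_plus C \<rho>)"
    unfolding nat_trans_index_iff using vec pull plus_closed plus_natural by simp
  show ?thesis
    unfolding two_cell_structure_def internal_category_def
    by (intro conjI dom cod zero plus) (auto simp: index_cat_sel vec_defs units assoc)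
qed

end


section \<open>The subcategory given by a section of the forgetful functor\<close>

text \<open>Since \<open>VQ = U\<close> and \<open>QR = 1\<close>, the section satisfies \<open>UR = V\<close>: the structure \<open>R(B)\<close> has
  carrier \<open>V(B)\<close>, and \<open>R(u)\<close> has underlying arrow \<open>V(u)\<close>.\<close>

context
  fixes C :: "('o, 'a) cat" and Cs :: "('p, 'b) cat"
    and Q :: "(('o, 'a) bla, ('o, 'a) bla \<times> 'a \<times> ('o, 'a) bla, 'p, 'b) func"
    and R :: "('p, 'b, ('o, 'a) bla, ('o, 'a) bla \<times> 'a \<times> ('o, 'a) bla) func"
    and V :: "('p, 'b, 'o, 'a) func"
  assumes C: "category C" and Cs: "category Cs"
    and R: "is_functor Cs (Bla C) R" and V: "mono_Cat Cs C V"
    and VQ: "functor_eq (Bla C) forget_Bla (comp_functor V Q)"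
    and QR: "functor_eq Cs (comp_functor Q R) id_functor"
begin

lemma section_bla_obj:
  assumes "B \<in> Obj Cs"
  shows "bla_obj C (omap R B)" "bobj (omap R B) = omap V B"
proof -
  have "omap R B \<in> Obj (Bla C)" using R assms by (simp add: is_functor_def)
  then show "bla_obj C (omap R B)" "bobj (omap R B) = omap V B"
    using VQ QR assms
    by (simp_all add: Bla_def functor_eq_def forget_Bla_def comp_functor_def id_functor_def)
qed

lemma section_bla_mor:
  assumes "u \<in> Arr Cs"
  shows "bla_mor C (omap R (src Cs u)) (omap R (tgt Cs u)) (amap V u)"
proof -
  have h: "amap R u \<in> hom (Bla C) (omap R (src Cs u)) (omap R (tgt Cs u))"
    using R assms by (simp add: is_functor_def)
  then obtain w where w: "amap R u = (omap R (src Cs u), w, omap R (tgt Cs u))"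
    "bla_mor C (omap R (src Cs u)) (omap R (tgt Cs u)) w"
    by (auto simp: hom_iff Bla_def)
  have "amap V (amap Q (amap R u)) = w"
    using VQ h w(1) by (auto simp: functor_eq_def forget_Bla_def comp_functor_def hom_iff)
  then have "w = amap V u"
    using QR assms by (simp add: functor_eq_def comp_functor_def id_functor_def)
  then show ?thesis using w(2) by simp
qed

lemma bla_at_omap:
  assumes "B \<in> Obj Cs"
  shows "bla_at Cs V R (omap V B) = omap R B"
proof -
  have "(THE B'. B' \<in> Obj Cs \<and> omap V B' = omap V B) = B"
    using assms mono_Cat_inj(1)[OF Cs C V] by (auto dest: inj_onD)
  then show ?thesis by (simp add: bla_at_def)
qed

lemma structured_image_cat: "structured_subcategory C (image_cat Cs C V) (bla_at Cs V R)"
proof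
  have VF: "is_functor Cs C V" using V by (simp add: mono_Cat_def)
  show "category C" by (rule C)
  show "category (image_cat Cs C V)" by (rule category_image_cat[OF C Cs V])
  show "Arr (image_cat Cs C V) \<subseteq> Arr C"
    using VF by (auto simp: image_cat_def is_functor_def hom_iff)
  show "bla_obj C (bla_at Cs V R B)" "bobj (bla_at Cs V R B) = B"
    if "B \<in> Obj (image_cat Cs C V)" for B
    using that section_bla_obj bla_at_omap by (auto simp: image_cat_def)
  show "bla_mor C (bla_at Cs V R B) (bla_at Cs V R B') u"
    if "u \<in> hom (image_cat Cs C V) B B'" for u B B'
  proof -
    have "u \<in> amap V ` Arr Cs" "src C u = B" "tgt C u = B'"
      using that by (simp_all add: hom_iff image_cat_def)
    then obtain u' where u': "u' \<in> Arr Cs" "u = amap V u'" "src C u = B" "tgt C u = B'"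
      by blast
    then have "B = omap V (src Cs u')" "B' = omap V (tgt Cs u')"
      using VF by (auto simp: is_functor_def hom_iff)
    moreover have "src Cs u' \<in> Obj Cs" "tgt Cs u' \<in> Obj Cs"
      using Cs u'(1) by (auto simp: category_def)
    ultimately show ?thesis
      using section_bla_mor[OF u'(1)] u'(2) bla_at_omap by simp
  qed
qed (simp_all add: image_cat_def)

end


section \<open>Families of column vectors that form 2-cell structures\<close>

theorem theorem4p2:
  fixes C :: "('o, 'a) cat" and Cs :: "('p, 'b) cat"
    and Q :: "(('o, 'a) bla, ('o, 'a) bla \<times> 'a \<times> ('o, 'a) bla, 'p, 'b) func"
    and R :: "('p, 'b, ('o, 'a) bla, ('o, 'a) bla \<times> 'a \<times> ('o, 'a) bla) func"
    and V :: "('p, 'b, 'o, 'a) func"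
    and H :: "'o \<Rightarrow> 'o \<Rightarrow> ('a \<times> 'a \<times> 'a) set"
  defines "D \<equiv> image_cat Cs C V"
    and "\<rho> \<equiv> bla_at Cs V R"
  assumes "category C" and "category Cs"
    and "is_functor (Bla C) Cs Q" and "is_functor Cs (Bla C) R" and "mono_Cat Cs C V"
    and "functor_eq (Bla C) forget_Bla (comp_functor V Q)"
    and "functor_eq Cs (comp_functor Q R) id_functor"
    and "\<And>A B. A \<in> Obj D \<Longrightarrow> B \<in> Obj D \<Longrightarrow> H A B \<subseteq> sobj (H_R C \<rho>) (A, B)"
  shows "two_cell_structure D \<lparr>sobj = (\<lambda>(A, B). H A B), sarr = sarr (H_R C \<rho>)\<rparr>
           vec_dom vec_cod (vec_zero C \<rho>) (vec_plus C \<rho>)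
    \<longleftrightarrow>
      (\<forall>A\<in>Obj D. \<forall>A'\<in>Obj D. \<forall>B\<in>Obj D. \<forall>B'\<in>Obj D. \<forall>f t g.
         (f, t, g) \<in> H A B \<longrightarrow>
         (\<forall>u\<in>hom D B B'. \<forall>v\<in>hom D A' A.
            (u \<cdot>\<^bsub>C\<^esub> f \<cdot>\<^bsub>C\<^esub> v, u \<cdot>\<^bsub>C\<^esub> t \<cdot>\<^bsub>C\<^esub> v, u \<cdot>\<^bsub>C\<^esub> g \<cdot>\<^bsub>C\<^esub> v) \<in> H A' B')) \<and>
      (\<forall>A\<in>Obj D. \<forall>B\<in>Obj D. \<forall>f t g. (f, t, g) \<in> H A B \<longrightarrow> f \<in> Arr D \<and> g \<in> Arr D) \<and>
      (\<forall>A\<in>Obj D. \<forall>B\<in>Obj D. \<forall>f\<in>hom D A B. (f, bend (\<rho> B) \<cdot>\<^bsub>C\<^esub> f, f) \<in> H A B) \<and>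
      (\<forall>A\<in>Obj D. \<forall>B\<in>Obj D. \<forall>f t g t' h. (g, t', h) \<in> H A B \<longrightarrow> (f, t, g) \<in> H A B \<longrightarrow>
         vec_plus C \<rho> (A, B) ((g, t', h), (f, t, g)) \<in> H A B) \<and>
      (\<forall>A\<in>Obj D. \<forall>B\<in>Obj D. \<forall>f t g. (f, t, g) \<in> H A B \<longrightarrow>
         mval C (\<rho> B) t f (bend (\<rho> B) \<cdot>\<^bsub>C\<^esub> f) = t \<and>
         t = mval C (\<rho> B) (bend (\<rho> B) \<cdot>\<^bsub>C\<^esub> g) g t) \<and>
      (\<forall>A\<in>Obj D. \<forall>B\<in>Obj D. \<forall>f t g t' h t'' k.
         (h, t'', k) \<in> H A B \<longrightarrow> (g, t', h) \<in> H A B \<longrightarrow> (f, t, g) \<in> H A B \<longrightarrow>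
         mval C (\<rho> B) t'' h (mval C (\<rho> B) t' g t) =
         mval C (\<rho> B) (mval C (\<rho> B) t'' h t') g t)"
proof -
  have "structured_subcategory C D \<rho>"
    unfolding D_def \<rho>_def using assms(3,4,6-9) by (rule structured_image_cat)
  then interpret vector_family C D \<rho> H
    by (intro vector_family.intro vector_family_axioms.intro assms)
  show ?thesis (is "?two_cell \<longleftrightarrow> ?closure_and_laws")
  proof
    assume ?two_cell
    note two_cell = two_cell_structureD[OF this]
    show ?closure_and_laws
      apply (intro conjI ballI allI impI)
      subgoal by (rule two_cell(1))
      subgoal using two_cell(2) by blast
      subgoal using two_cell(2) by blast
      subgoal by (rule two_cell(3))
      subgoal unfolding vec_plus_def prod.case by (rule two_cell(4))
      subgoal by (rule two_cell(5))
      subgoal by (rule two_cell(6)[symmetric])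
      subgoal by (rule two_cell(7))
      done
  next
    assume laws: ?closure_and_laws
    have objs: "A \<in> Obj D" "B \<in> Obj D" if "k \<in> hom D A B" for k A B
      using hom_Obj[OF D that] .
    show ?two_cell
    proof (rule two_cell_structureI, goal_cases action ends zeros sums units assoc)
      case action
      then show ?case using laws[THEN conjunct1] objs by blast
    next
      case ends
      then show ?case using laws[THEN conjunct2, THEN conjunct1] by blast
    next
      case zeros
      then show ?case
        using laws[THEN conjunct2, THEN conjunct2, THEN conjunct1] objs by blast
    next
      case sums
      then show ?case
        using laws[THEN conjunct2, THEN conjunct2, THEN conjunct2, THEN conjunct1]
        unfolding vec_plus_def prod.case by blast
    next
      case units
      then show ?case
        using laws[THEN conjunct2, THEN conjunct2, THEN conjunct2, THEN conjunct2, THEN conjunct1]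
        by metis
    next
      case assoc
      then show ?case
        using laws[THEN conjunct2, THEN conjunct2, THEN conjunct2, THEN conjunct2, THEN conjunct2]
        by blast
    qed
  qed
qed

end
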